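(* Let $K$ be either the finite field $\mathbb{F}_p$ with $p$ any prime number, or the field $\mathbb{Q}$. Let $W=(w(n))_{n\geq 1}$ be the infinite sequence over $\{1,2\}$ defined in the context, and let $\theta=\sum_{n\geq 1}w(n)T^{-n}$, considered as an element of $K((T^{-1}))$. Then $\theta$ is transcendental over $K(T)$.
   Context: Define finite words over the alphabet $\{1,2\}$ recursively by $W_0=\epsilon$ (the empty word), $W_1=1$, and $W_n=W_{n-1}\,2\,W_{n-2}\,2\,W_{n-1}$ (concatenation) for $n\geq 2$. Each $W_n$ is a prefix of $W_{n+1}$, and $W=(w(n))_{n\geq 1}$ is the infinite sequence that begins with $W_n$ for every $n\geq 0$. When $K=\mathbb{F}_p$, the integers $w(n)\in\{1,2\}$ are viewed in $K$ by reduction modulo $p$. $K((T^{-1}))$ is the field of formal power series in $1/T$ over $K$, whose nonzero elements are $\sum_{k\leq k_0}c_kT^k$ with $k_0\in\mathbb{Z}$, $c_k\in K$, $c_{k_0}\neq 0$; it contains the field $K(T)$ of rational functions. *)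

theory Defs
  imports
    "HOL-Computational_Algebra.Computational_Algebra"
    "HOL-Algebra.Algebraic_Closure_Type"
    "Berlekamp_Zassenhaus.Finite_Field"
begin

fun word :: "nat \<Rightarrow> nat list" where
  "word 0 = []"
| "word (Suc 0) = [1]"
| "word (Suc (Suc n)) = word (Suc n) @ [2] @ word n @ [2] @ word (Suc n)"

lemma length_word_ge: "n \<le> length (word n)"
  by (induction n rule: word.induct) auto

lemma word_prefix_Suc: "\<exists>u. word (Suc n) = word n @ u"
  by (cases n) auto

lemma word_prefix: "m \<le> n \<Longrightarrow> \<exists>u. word n = word m @ u"
proof (induction n rule: dec_induct)
  case base
  show ?case by simp
next
  case (step n)
  then show ?case using word_prefix_Suc[of n] by (metis append_assoc)
qed

text \<open>
  Indexing starts at 1; the value at 0 is irrelevant. The letter is read off \<open>word n\<close>, which has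
  length at least \<open>n\<close>; lemma \<open>w_begins_with_word\<close> shows that the sequence begins with
  every \<open>word n\<close>.
\<close>

definition w :: "nat \<Rightarrow> nat" where
  "w n = word n ! (n - 1)"

lemma w_begins_with_word:
  assumes "1 \<le> i" "i \<le> length (word n)"
  shows "w i = word n ! (i - 1)"
proof -
  have i: "i - 1 < length (word i)"
    using length_word_ge[of i] assms(1) by linarith
  show ?thesis
  proof (cases "i \<le> n")
    case True
    then obtain u where "word n = word i @ u" using word_prefix by blast
    with i show ?thesis by (simp add: w_def nth_append)
  next
    case False
    then obtain u where u: "word i = word n @ u" using word_prefix[of n i] by auto
    have "i - 1 < length (word n)" using assms by linarith
    with u show ?thesis by (simp add: w_def nth_append)
  qed
qed

corollary map_w_eq_word: "map w [1..<Suc (length (word n))] = word n"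
proof (rule nth_equalityI)
  fix i assume "i < length (map w [1..<Suc (length (word n))])"
  then show "map w [1..<Suc (length (word n))] ! i = word n ! i"
    using w_begins_with_word[of "Suc i" n] by (simp del: upt_Suc)
qed (simp del: upt_Suc)

lemma w_range: "1 \<le> n \<Longrightarrow> w n \<in> {1, 2}"
proof -
  assume n: "1 \<le> n"
  have "set (word n) \<subseteq> {1, 2}" for n
    by (induction n rule: word.induct) auto
  moreover have "w n \<in> set (word n)"
    using length_word_ge[of n] n by (auto simp: w_def intro!: nth_mem)
  ultimately show ?thesis by blast
qed

text \<open>
  The field $K((T^{-1}))$ is \<open>'k fls\<close>, the formal Laurent series in the variable
  \<open>fls_X\<close> $= T^{-1}$, so that $T$ is \<open>fls_X_inv\<close>. The next two definitions are the
  images of $K[T]$ and $K(T)$ in it.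
\<close>

definition poly_in_T :: "'k :: field poly \<Rightarrow> 'k fls" where
  "poly_in_T p = poly (map_poly fls_const p) fls_X_inv"

definition rational_functions :: "'k :: field fls set" where
  "rational_functions = {poly_in_T p / poly_in_T q | p q. q \<noteq> 0}"

lemma poly_in_T_hom:
  "poly_in_T (p + q) = poly_in_T p + poly_in_T q"
  "poly_in_T (p * q) = poly_in_T p * poly_in_T q"
  "poly_in_T (- p) = - poly_in_T p"
  "poly_in_T 0 = 0" "poly_in_T 1 = 1"
proof -
  interpret map_poly_comm_ring_hom "fls_const :: 'a \<Rightarrow> 'a fls"
    by unfold_locales (simp_all add: fls_plus_const fls_const_mult_const)
  show "poly_in_T (p + q) = poly_in_T p + poly_in_T q"
    "poly_in_T (p * q) = poly_in_T p * poly_in_T q"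
    "poly_in_T (- p) = - poly_in_T p"
    "poly_in_T 0 = 0" "poly_in_T 1 = 1"
    by (simp_all add: poly_in_T_def hom_add hom_mult hom_uminus)
qed

definition theta :: "'k :: field fls" where
  "theta = fps_to_fls (Abs_fps (\<lambda>n. if n = 0 then 0 else of_nat (w n)))"

lemma theta_nth: "fls_nth theta k = (if k \<ge> 1 then of_nat (w (nat k)) else 0)"
  by (auto simp: theta_def)

lemma poly_in_T_nth:
  "fls_nth (poly_in_T p) k = (if k \<le> 0 then Polynomial.coeff p (nat (- k)) else 0)"
proof (induction p arbitrary: k)
  case 0
  show ?case by (simp add: poly_in_T_def)
next
  case (pCons a p)
  have "poly_in_T (pCons a p) = fls_const a + fls_X_inv * poly_in_T p"
    using pCons by (simp add: poly_in_T_def map_poly_pCons)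
  then show ?case
    by (auto simp: pCons.IH fls_X_inv_times_conv_shift coeff_pCons nat_diff_distrib' split: nat.splits
             intro!: arg_cong[where f = "Polynomial.coeff p"])
qed

lemma poly_in_T_eq_0_iff: "poly_in_T p = 0 \<longleftrightarrow> p = 0"
proof
  assume "poly_in_T p = 0"
  then have "Polynomial.coeff p n = 0" for n
    using poly_in_T_nth[of p "- int n"] by simp
  then show "p = 0" by (simp add: poly_eq_iff)
qed (simp add: poly_in_T_hom)

lemma subfield_rational_functions:
  "subfield rational_functions (ring_of_type_algebra :: 'k :: field fls ring)"
proof -
  let ?R = "ring_of_type_algebra :: 'k fls ring"
  interpret F: Ring.field ?R by (rule field_from_type_algebra)
  have simps: "carrier ?R = UNIV" "monoid.mult ?R = (*)" "one ?R = 1"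
      "ring.zero ?R = 0" "add ?R = (+)"
    by (simp_all add: ring_of_type_algebra_def)
  have a_inv: "a_inv ?R x = - x" for x
    using F.minus_equality[of "- x" x] by (simp add: simps)
  have m_inv: "m_inv ?R x = inverse x" if "x \<noteq> 0" for x
    using F.comm_inv_char[of x "inverse x"] that by (simp add: simps)
  have memI: "poly_in_T p / poly_in_T q \<in> rational_functions" if "q \<noteq> 0" for p q :: "'k poly"
    using that by (auto simp: rational_functions_def)
  have closed: "- x \<in> rational_functions" "x + y \<in> rational_functions"
      "x * y \<in> rational_functions" "x \<noteq> 0 \<Longrightarrow> inverse x \<in> rational_functions"
    if "x \<in> rational_functions" "y \<in> rational_functions" for x y :: "'k fls"
  proof -
    from that obtain a b c d where [simp]: "b \<noteq> 0" "d \<noteq> 0"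
      and x: "x = poly_in_T a / poly_in_T b" and y: "y = poly_in_T c / poly_in_T d"
      by (auto simp: rational_functions_def)
    show "- x \<in> rational_functions"
      using memI[of b "- a"] by (simp add: x poly_in_T_hom)
    show "x + y \<in> rational_functions"
      using memI[of "b * d" "a * d + c * b"]
      by (simp add: x y poly_in_T_hom add_frac_eq poly_in_T_eq_0_iff)
    show "x * y \<in> rational_functions"
      using memI[of "b * d" "a * c"] by (simp add: x y poly_in_T_hom)
    show "inverse x \<in> rational_functions" if "x \<noteq> 0"
      using memI[of a b] that by (auto simp: x poly_in_T_eq_0_iff)
  qed
  have one: "1 \<in> (rational_functions :: 'k fls set)"
    using memI[of 1 1] by (simp add: poly_in_T_hom)
  have "subring rational_functions ?R"
    by (rule F.subringI) (auto simp: simps a_inv one closed)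
  moreover have "m_inv ?R k \<in> rational_functions"
    if "k \<in> rational_functions - {\<zero>\<^bsub>?R\<^esub>}" for k
    using that by (auto simp: simps m_inv closed)
  ultimately show ?thesis
    by (intro F.subfieldI')
qed

end

theory Submission
  imports Defs "HOL-Analysis.Kronecker_Approximation_Theorem"
begin

text \<open>
  The sequence \<open>w\<close> is fixed by the substitution $1 \mapsto 122$, $2 \mapsto 12$. Hence the number
  of ones among its first $n$ letters is $\lfloor n\alpha + \rho\rfloor$ with $\alpha = \sqrt 2 - 1$ and
  $\rho = 1/\sqrt 2$, so \<open>w\<close> codes a rotation by the irrational angle $\alpha$. Since the orbit
  of an irrational rotation is dense, the subsequences $n \mapsto w(qn+r)$, $0 \le r < q$, are
  pairwise distinct for every $q$.

  If \<open>theta\<close> were algebraic over $\mathbb{F}_p(T)$, its powers with exponents $p^i$ would be linearly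
  dependent, and applying Cartier operators to such a relation leaves only finitely many series
  $\sum_n w(p^k n + r)T^{-n}$ (the easy direction of Christol's theorem); but there are at
  least $p^k$ of them for every $k$.

  Over $\mathbb{Q}$, a linear relation between the powers with exponents $2^i$, scaled to have integer
  coefficients that are not all even, reduces modulo 2 to a relation that was just excluded.
\<close>

section \<open>The rotation coding of the sequence\<close>

definition ones :: "nat \<Rightarrow> nat" where
  "ones n = count_list (map w [1..<Suc n]) 1"

text \<open>The trailing 2 absorbs the separators of the recursion: B(n+2) = B(n+1) B(n) B(n+1), a
  form that every substitution preserves.\<close>

definition block :: "nat \<Rightarrow> nat list" where
  "block n = word n @ [2]"

text \<open>Each image starts with 1 and contains no other 1; the image of 1 is one letter longer.
  The counting below rests on this.\<close>

definition subst_letter :: "nat \<Rightarrow> nat list" where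
  "subst_letter a = (if a = 1 then [1, 2, 2] else [1, 2])"

abbreviation subst :: "nat list \<Rightarrow> nat list" where
  "subst xs \<equiv> concat (map subst_letter xs)"

text \<open>Substitution respects concatenation, so the recursion of the blocks leaves only
  \<open>n = 0\<close> and \<open>n = 1\<close> to check.\<close>

lemma subst_block: "subst (block n) = block (Suc n)"
  by (induction n rule: word.induct) (simp_all add: block_def subst_letter_def)

lemma length_subst: "length (subst xs) = 2 * length xs + count_list xs 1"
  by (induction xs) (auto simp: subst_letter_def)

lemma count_subst: "count_list (subst xs) 1 = length xs"
  by (induction xs) (auto simp: subst_letter_def)

text \<open>The final 2 of a block lies outside \<open>word N\<close>; a nonempty \<open>v\<close>
  keeps it out of \<open>u\<close>.\<close>

lemma block_prefix:
  assumes "block N = u @ v" "v \<noteq> []"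
  shows "map w [1..<Suc (length u)] = u"
proof -
  have len: "length u \<le> length (word N)"
    using arg_cong[OF assms(1), of length] assms(2) by (cases v) (auto simp: block_def)
  have "map w [1..<Suc (length u)] = take (length u) (map w [1..<Suc (length (word N))])"
    using len by (simp add: take_map take_upt del: upt_Suc)
  also have "\<dots> = take (length u) (block N)"
    unfolding map_w_eq_word using len by (simp add: block_def)
  also have "\<dots> = u" by (simp add: assms(1))
  finally show ?thesis .
qed

text \<open>The image of the first j letters is a prefix of the sequence, of length
  \<open>2 * j + ones j\<close> and with one 1 per original letter. The next letter opens a new
  image and is therefore 1.\<close>

lemma
  shows ones_subst: "ones (2 * j + ones j) = j"
    and ones_subst_Suc: "ones (Suc (2 * j + ones j)) = Suc j"
proof -
  define u where "u = take j (block j)"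
  have len: "length (block j) > j"
    using length_word_ge[of j] by (simp add: block_def)
  obtain a v where v: "block j = u @ a # v"
    using id_take_nth_drop[OF len] unfolding u_def by blast
  have lu: "length u = j" using len by (simp add: u_def)
  have pu: "map w [1..<Suc j] = u" using block_prefix[of j u "a # v"] v lu by simp
  have lsu: "length (subst u) = 2 * j + ones j"
    unfolding length_subst ones_def pu lu ..
  \<comment> \<open>Since an image has a second letter \<open>x\<close>, something remains after the
    appended 1 and \<open>block_prefix\<close> applies.\<close>
  obtain x t where t: "subst_letter a = 1 # x # t"
    by (cases "a = 1") (auto simp: subst_letter_def)
  have b: "block (Suc j) = subst u @ 1 # x # t @ subst v"
    unfolding subst_block[symmetric] v by (simp add: t)
  show "ones (2 * j + ones j) = j"
    using block_prefix[OF b] count_subst[of u] unfolding lsu ones_def[of "2 * j + ones j"]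
    by (simp add: lu del: upt_Suc)
  show "ones (Suc (2 * j + ones j)) = Suc j"
    using block_prefix[of "Suc j" "subst u @ [1]" "x # t @ subst v"] b lsu count_subst[of u]
    unfolding ones_def[of "Suc (2 * j + ones j)"] by (simp add: lu del: upt_Suc)
qed

lemma ones_0: "ones 0 = 0" by (simp add: ones_def)

lemma ones_Suc: "ones (Suc n) = ones n + (if w (Suc n) = 1 then 1 else 0)"
  by (simp add: ones_def)

lemma mono_ones: "mono ones"
  by (rule incseq_SucI) (simp add: ones_Suc)

lemma ones_le: "ones n \<le> n"
  by (induction n) (simp_all add: ones_0 ones_Suc)

section \<open>Irrationality of the square root of 2 and the floor formula\<close>

lemma sqrt2_bounds: "7 / 5 < sqrt 2" "sqrt 2 < 3 / 2"
  by (rule real_less_rsqrt real_less_lsqrt; simp add: power2_eq_square)+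

lemma sqrt2_not_rat: "sqrt 2 \<notin> \<rat>"
proof
  assume "sqrt 2 \<in> \<rat>"
  then obtain a b :: int where b: "b > 0" "coprime a b" and s: "sqrt 2 = of_int a / of_int b"
    by (meson Rats_cases')
  have "(of_int a :: real)\<^sup>2 = 2 * (of_int b)\<^sup>2"
    using b s by (metis nonzero_eq_divide_eq of_int_0_eq_iff order_less_irrefl power_divide
        power_not_zero real_sqrt_pow2 zero_le_numeral)
  then have eq: "a\<^sup>2 = 2 * b\<^sup>2"
    by (metis (mono_tags) of_int_eq_iff of_int_mult of_int_numeral of_int_power)
  then have "even a" by (metis dvd_triv_left even_power)
  then obtain c where c: "a = 2 * c" by blast
  then have "b\<^sup>2 = 2 * c\<^sup>2" using eq by (simp add: power_mult_distrib)
  then have "even b" by (metis dvd_triv_left even_power)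
  with \<open>even a\<close> b(2) show False by (meson coprime_common_divisor odd_one)
qed

lemma sqrt2_mult_add_not_int:
  fixes a b :: rat
  assumes "a \<noteq> 0"
  shows "of_rat a * sqrt 2 + of_rat b \<notin> \<int>"
proof
  assume "of_rat a * sqrt 2 + of_rat b \<in> \<int>"
  then have "of_rat a * sqrt 2 + of_rat b \<in> \<rat>"
    using Ints_subset_Rats by blast
  then have "(of_rat a * sqrt 2 + of_rat b - of_rat b) / of_rat a \<in> \<rat>"
    by (intro Rats_divide Rats_diff) auto
  with assms sqrt2_not_rat show False by simp
qed

text \<open>
  The $j$-th letter 1 stands at position \<open>Suc (2 * i + ones i)\<close> with $j = i + 1$. The intercept
  $\rho$ is determined by $\rho(1+\alpha) = 1$, which makes the recursion for the floor function
  match this one.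
\<close>
lemma ones_eq_floor: "int (ones n) = \<lfloor>real n * (sqrt 2 - 1) + sqrt 2 / 2\<rfloor>"
proof (induction n rule: less_induct)
  case (less n)
  define a where "a = sqrt 2 - 1"
  define \<rho> where "\<rho> = sqrt 2 / 2"
  have sq: "sqrt 2 * sqrt 2 = 2" by simp
  note s = sqrt2_bounds
  have a: "a * (2 + a) = 1" and \<rho>: "\<rho> * (1 + a) = 1"
    using sq by (simp_all add: a_def \<rho>_def algebra_simps)
  have "a > 0" using s by (simp add: a_def)
  define j where "j = ones n"
  have o1: "ones 1 = 1" using ones_subst_Suc[of 0] by (simp add: ones_0)
  \<comment> \<open>The step uses the formula at \<open>j = ones n\<close>, which is smaller than
    \<open>n\<close> only from \<open>n = 2\<close> on.\<close>
  show ?case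
  proof (cases "n \<le> 1")
    case True
    then consider "n = 0" | "n = 1" by linarith
    then show ?thesis
    proof cases
      case 1
      then show ?thesis using s by (simp add: ones_0 floor_eq_iff)
    next
      case 2
      then show ?thesis using s o1 by (simp add: floor_eq_iff)
    qed
  next
    case False
    then have "j \<ge> 1" using o1 monoD[OF mono_ones, of 1 n] by (simp add: j_def)
    then obtain i where i: "j = Suc i" by (cases j) auto
    \<comment> \<open>Together, \<open>lo\<close> and \<open>hi\<close> place \<open>n\<close>
      between the position of the j-th 1 and the last position before the next 1.\<close>
    have lo: "n \<ge> Suc (2 * i + ones i)"
    proof (rule ccontr)
      assume "\<not> ?thesis"
      then have "ones n \<le> ones (2 * i + ones i)" by (intro monoD[OF mono_ones]) simp
      then show False by (simp add: ones_subst i flip: j_def)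
    qed
    have hi: "n \<le> 2 * j + ones j"
    proof (rule ccontr)
      assume "\<not> ?thesis"
      then have "ones (Suc (2 * j + ones j)) \<le> ones n" by (intro monoD[OF mono_ones]) simp
      then show False by (simp add: ones_subst_Suc flip: j_def)
    qed
    have ij: "i < n" "j < n" using lo i False by auto
    have fi: "int (ones i) = \<lfloor>real i * a + \<rho>\<rfloor>" and fj: "int (ones j) = \<lfloor>real j * a + \<rho>\<rfloor>"
      using less.IH[OF ij(1)] less.IH[OF ij(2)] by (simp_all add: a_def \<rho>_def)
    \<comment> \<open>The identities for \<open>a\<close> and \<open>\<rho>\<close> collapse the
      right-hand side to i + 1.\<close>
    have "real j = (2 * real j - 2 + real i * a + \<rho>) * a + \<rho>"
    proof -
      have "(2 * real j - 2 + real i * a + \<rho>) * a + \<rho> = real i * (a * (2 + a)) + \<rho> * (1 + a)"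
        unfolding i by (simp add: algebra_simps)
      then show ?thesis unfolding a \<rho> by (simp add: i)
    qed
    also have "\<dots> \<le> real n * a + \<rho>"
    proof -
      have "real i * a + \<rho> < real (ones i) + 1" using fi by linarith
      then have "2 * real j - 2 + real i * a + \<rho> \<le> real n" using lo i by linarith
      then show ?thesis using \<open>a > 0\<close> by simp
    qed
    finally have 1: "real j \<le> real n * a + \<rho>" .
    \<comment> \<open>This number is (j + 1/2) sqrt 2 - j, hence irrational, which makes the upper
      bound strict.\<close>
    have "real j * a + \<rho> \<notin> \<int>"
      using sqrt2_mult_add_not_int[of "of_nat j + 1 / 2" "- of_nat j"]
      by (simp add: a_def \<rho>_def of_rat_add of_rat_minus of_rat_divide algebra_simps add_eq_0_iff)
    then have "real (ones j) \<noteq> real j * a + \<rho>"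
      by (metis Ints_of_nat)
    then have "real (ones j) < real j * a + \<rho>" using fj by linarith
    then have "real n < 2 * real j + real j * a + \<rho>" using hi by linarith
    then have "real n * a + \<rho> < (2 * real j + real j * a + \<rho>) * a + \<rho>"
      using \<open>a > 0\<close> by simp
    also have "\<dots> = real j * (a * (2 + a)) + \<rho> * (1 + a)" by (simp add: algebra_simps)
    also have "\<dots> = real j + 1" unfolding a \<rho> by simp
    finally have "real n * a + \<rho> < real j + 1" .
    with 1 show ?thesis unfolding a_def[symmetric] \<rho>_def[symmetric] j_def[symmetric]
      by linarith
  qed
qed

text \<open>The letter is 1 exactly when the floor jumps, and a step of length below 1 makes it jump
  exactly when the new fractional part is smaller than that length.\<close>

lemma w_eq_1_iff_frac:
  assumes "n \<ge> 1"
  shows "w n = 1 \<longleftrightarrow> frac (real n * (sqrt 2 - 1) + sqrt 2 / 2) < sqrt 2 - 1"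
proof -
  obtain m where m: "n = Suc m" using assms by (cases n) auto
  define y where "y = real m * (sqrt 2 - 1) + sqrt 2 / 2"
  have y: "real n * (sqrt 2 - 1) + sqrt 2 / 2 = y + (sqrt 2 - 1)"
    by (simp add: m y_def algebra_simps)
  have f: "int (ones m) = \<lfloor>y\<rfloor>" "int (ones n) = \<lfloor>y + (sqrt 2 - 1)\<rfloor>"
    unfolding ones_eq_floor y by (simp_all add: y_def)
  have "w n = 1 \<longleftrightarrow> \<lfloor>y + (sqrt 2 - 1)\<rfloor> = \<lfloor>y\<rfloor> + 1"
    unfolding f[symmetric] unfolding m ones_Suc by simp
  also have "\<dots> \<longleftrightarrow> frac (y + (sqrt 2 - 1)) < sqrt 2 - 1"
    unfolding frac_def using sqrt2_bounds by linarith
  finally show ?thesis by (simp add: y)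
qed

text \<open>Modulo 1, the points coding the two letters differ by the nonzero constant
  \<open>\<delta>\<close>. Some open interval inside [0, a) is carried out of [0, a) by this shift,
  and density of the multiples of \<open>q * a\<close> provides an \<open>n\<close> that hits
  it.\<close>

lemma w_progressions_differ:
  assumes q: "q > 0" and rr: "r < r'"
  shows "\<exists>n\<ge>1. w (q * n + r) \<noteq> w (q * n + r')"
proof -
  define a where "a = sqrt 2 - 1"
  define \<rho> where "\<rho> = sqrt 2 / 2"
  define d where "d = r' - r"
  define \<delta> where "\<delta> = frac (real d * a)"
  have a: "0 < a" "2 * a < 1"
    using sqrt2_bounds by (simp_all add: a_def)
  have "d \<noteq> 0" using rr by (simp add: d_def)
  then have "real d * a \<notin> \<int>"
    using sqrt2_mult_add_not_int[of "of_nat d" "- of_nat d"]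
    by (simp add: a_def of_rat_minus right_diff_distrib)
  then have \<delta>: "0 < \<delta>" "\<delta> < 1" by (auto simp: \<delta>_def frac_lt_1 frac_gt_0_iff)
  \<comment> \<open>If \<open>\<delta> \<ge> a\<close>, points just above 0 are moved past
    \<open>a\<close>; otherwise points just below \<open>a\<close> are, and they stay below 1
    because \<open>2 * a < 1\<close>.\<close>
  obtain lo hi where J: "0 \<le> lo" "lo < hi" "hi \<le> a" "\<And>x. lo < x \<Longrightarrow> x < hi \<Longrightarrow> a \<le> x + \<delta> \<and> x + \<delta> < 1"
  proof (cases "\<delta> \<ge> a")
    case True
    then show ?thesis using that[of 0 "min a (1 - \<delta>)"] a \<delta> by auto
  next
    case False
    then show ?thesis using that[of "a - \<delta>" a] a \<delta> by auto
  qed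
  define mid where "mid = (lo + hi) / 2"
  have irr: "real q * a \<notin> \<rat>"
  proof
    assume "real q * a \<in> \<rat>"
    then have "real q * a / real q + 1 \<in> \<rat>" by (intro Rats_divide Rats_add) auto
    then show False using q sqrt2_not_rat by (simp add: a_def)
  qed
  define z where "z = mid - (real r * a + \<rho>)"
  obtain n where n: "n > 0" "\<bar>frac (real n * (real q * a)) - frac z\<bar> < (hi - lo) / 2"
    using Kronecker_approx_1_explicit[OF irr, of "frac z" "(hi - lo) / 2"] J(2)
    by (auto simp: frac_lt_1 less_imp_le)
  \<comment> \<open>\<open>x\<close> represents the rotated point modulo 1, and
    \<open>x - mid\<close> is the difference of the two fractional parts estimated above.\<close>
  define x where "x = real (q * n + r) * a + \<rho> - \<lfloor>real n * (real q * a)\<rfloor> + \<lfloor>z\<rfloor>"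
  have x: "lo < x" "x < hi"
    using n(2) unfolding frac_def x_def z_def mid_def by (simp_all add: algebra_simps abs_if field_simps split: if_splits)
  have f1: "frac (real (q * n + r) * a + \<rho>) = x"
    unfolding frac_unique_iff using x J a by (auto simp: x_def)
  have rd: "real (q * n + r') * a + \<rho> = real (q * n + r) * a + \<rho> + real d * a"
    using rr by (simp add: d_def algebra_simps of_nat_diff)
  have f2: "frac (real (q * n + r') * a + \<rho>) = x + \<delta>"
    unfolding frac_unique_iff rd using x J(1) J(4)[of x] \<delta> by (auto simp: x_def \<delta>_def frac_def)
  have ge: "1 \<le> q * n + r" "1 \<le> q * n + r'" using q n by (simp_all add: Suc_le_eq)
  have "w (q * n + r) = 1" "w (q * n + r') \<noteq> 1"
    unfolding ge[THEN w_eq_1_iff_frac] a_def[symmetric] \<rho>_def[symmetric] f1 f2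
    using x J(3) J(4)[OF x] by auto
  with n(1) show ?thesis by (intro exI[of _ n]) auto
qed

section \<open>Cartier operators\<close>

text \<open>The Cartier operator in X = 1/T. For \<open>q > 0\<close> the selected coefficients
  again vanish far enough to the left, as a Laurent series requires.\<close>

definition decimate :: "nat \<Rightarrow> nat \<Rightarrow> 'a::zero fls \<Rightarrow> 'a fls" where
  "decimate q r f = Abs_fls (\<lambda>n. fls_nth f (int q * n + int r))"

lemma decimate_nth:
  assumes "q > 0"
  shows "fls_nth (decimate q r f) n = fls_nth f (int q * n + int r)"
proof -
  obtain K where K: "\<forall>n<K. fls_nth f n = 0" by (rule fls_nth_vanishes_belowE)
  have "fls_nth f (int q * n + int r) = 0" if "n < - \<bar>K\<bar> - int r" for n
  proof -
    have "int q * n \<le> 1 * n" using that assms by (intro mult_right_mono_neg) auto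
    then show ?thesis using that K by simp
  qed
  then show ?thesis unfolding decimate_def by (intro nth_Abs_fls_lower_bound) blast
qed

lemma decimate_add:
  "q > 0 \<Longrightarrow> decimate q r (f + g) = decimate q r f + decimate q r (g :: 'a::monoid_add fls)"
  by (simp add: fls_eq_iff decimate_nth)

lemma decimate_0: "q > 0 \<Longrightarrow> decimate q r 0 = 0"
  by (simp add: fls_eq_iff decimate_nth)

lemma decimate_sum:
  fixes f :: "'i \<Rightarrow> 'a::comm_monoid_add fls"
  shows "q > 0 \<Longrightarrow> decimate q r (\<Sum>i\<in>A. f i) = (\<Sum>i\<in>A. decimate q r (f i))"
  by (induction A rule: infinite_finite_induct) (simp_all add: decimate_add decimate_0)

lemma decimate_decimate:
  "p > 0 \<Longrightarrow> q > 0 \<Longrightarrow> decimate p s (decimate q r f) = decimate (q * p) (q * s + r) f"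
  by (simp add: fls_eq_iff decimate_nth algebra_simps)

text \<open>All exponents of X^s g(X^p) are congruent to s modulo p, and distinct residues below p
  are incongruent.\<close>

lemma nth_X_power_times_compose_power:
  fixes g :: "'a::comm_ring_1 fls"
  assumes "r < p" "s < p"
  shows "fls_nth (fls_X ^ s * fls_compose_power g p) (int p * n + int r) = (if s = r then fls_nth g n else 0)"
proof -
  have "p > 0" using assms by simp
  have "s = r" if "int p dvd int p * n + int r - int s"
  proof -
    have "int p dvd int r - int s"
      using that by (simp add: dvd_add_right_iff flip: add_diff_eq)
    then have "int r mod int p = int s mod int p" by (simp add: mod_eq_dvd_iff)
    then show ?thesis using assms by simp
  qed
  then show ?thesis
    using \<open>p > 0\<close> by (auto simp: fls_X_power_times_conv_shift fls_nth_compose_power)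
qed

lemma decimate_sum_X_power_times_compose_power:
  fixes h :: "nat \<Rightarrow> 'a::comm_ring_1 fls"
  assumes "r < p"
  shows "decimate p r (\<Sum>s<p. fls_X ^ s * fls_compose_power (h s) p) = h r"
proof (rule fls_eqI)
  fix n
  have "p > 0" using assms by simp
  have "fls_nth (decimate p r (\<Sum>s<p. fls_X ^ s * fls_compose_power (h s) p)) n
      = (\<Sum>s<p. fls_nth (fls_X ^ s * fls_compose_power (h s) p) (int p * n + int r))"
    using \<open>p > 0\<close> by (simp add: decimate_nth fls_nth_sum)
  also have "\<dots> = (\<Sum>s<p. if s = r then fls_nth (h r) n else 0)"
    using assms by (intro sum.cong) (simp_all add: nth_X_power_times_compose_power)
  finally show "fls_nth (decimate p r (\<Sum>s<p. fls_X ^ s * fls_compose_power (h s) p)) n = fls_nth (h r) n"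
    using assms by simp
qed

text \<open>Exponents are sorted by residue modulo p; every index has the form pn + r, and the
  previous lemma recovers the component for r.\<close>

lemma sum_X_power_times_decimate:
  fixes f :: "'a::comm_ring_1 fls"
  assumes "p > 0"
  shows "f = (\<Sum>s<p. fls_X ^ s * fls_compose_power (decimate p s f) p)" (is "_ = ?g")
proof (rule fls_eqI)
  fix k
  define r where "r = nat (k mod int p)"
  have r: "r < p" and k: "k = int p * (k div int p) + int r"
    using assms by (simp_all add: r_def nat_less_iff)
  have "fls_nth ?g k = fls_nth (decimate p r ?g) (k div int p)"
    using assms k by (simp add: decimate_nth)
  also have "\<dots> = fls_nth (decimate p r f) (k div int p)"
    by (simp only: decimate_sum_X_power_times_compose_power[OF r])
  also have "\<dots> = fls_nth f k" using assms k by (simp add: decimate_nth)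
  finally show "fls_nth f k = fls_nth ?g k" ..
qed

text \<open>The exponents of g(X^p) are divisible by p, so this factor multiplies each residue
  component separately.\<close>

lemma decimate_times_compose_power:
  fixes f g :: "'a::idom fls"
  assumes "r < p"
  shows "decimate p r (f * fls_compose_power g p) = decimate p r f * g"
proof -
  have "p > 0" using assms by simp
  have "f * fls_compose_power g p
      = (\<Sum>s<p. fls_X ^ s * fls_compose_power (decimate p s f) p) * fls_compose_power g p"
    using sum_X_power_times_decimate[OF \<open>p > 0\<close>, of f] by simp
  also have "\<dots> = (\<Sum>s<p. fls_X ^ s * fls_compose_power (decimate p s f * g) p)"
    by (simp add: sum_distrib_right mult.assoc)
  finally show ?thesis
    using decimate_sum_X_power_times_compose_power[OF assms, of "\<lambda>s. decimate p s f * g"] by simp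
qed

section \<open>Frobenius on series over F_p\<close>

text \<open>This is f^p = f(X^p). Writing f = a + X h gives f^p = a + X^p h^p, because Frobenius is
  additive and fixes F_p; the induction lowers the index by p.\<close>

lemma fps_nth_power_card:
  fixes f :: "'p::prime_card mod_ring fps"
  shows "fps_nth (f ^ CARD('p)) n = (if CARD('p) dvd n then fps_nth f (n div CARD('p)) else 0)"
proof (induction n arbitrary: f rule: less_induct)
  case (less n)
  let ?p = "CARD('p)"
  have p: "?p > 0" "prime ?p" using prime_card[where 'a = 'p] by (simp_all add: prime_gt_0_nat)
  have "f = fps_const (fps_nth f 0) + fps_X * fps_shift 1 f"
    by (rule fps_ext) auto
  then have "f ^ ?p = (fps_const (fps_nth f 0) + fps_X * fps_shift 1 f) ^ ?p" by simp
  also have "\<dots> = fps_const (fps_nth f 0) ^ ?p + (fps_X * fps_shift 1 f) ^ ?p"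
    using p(2) by (intro freshmans_dream) simp_all
  also have "\<dots> = fps_const (fps_nth f 0) + fps_X ^ ?p * fps_shift 1 f ^ ?p"
    using finite_field_power_card_eq_same[of "fps_nth f 0"] by (simp add: power_mult_distrib)
  finally have eq: "f ^ ?p = fps_const (fps_nth f 0) + fps_X ^ ?p * fps_shift 1 f ^ ?p" .
  show ?case
  proof (cases "n < ?p")
    case True
    then show ?thesis using p(1) unfolding eq by (auto simp: fps_X_power_mult_nth dest: dvd_imp_le)
  next
    case False
    then have le: "?p \<le> n" by simp
    with p(1) have "n > 0" by (rule less_le_trans)
    have "fps_nth (f ^ ?p) n = fps_nth (fps_shift 1 f ^ ?p) (n - ?p)"
      using le \<open>n > 0\<close> unfolding eq by (simp add: fps_X_power_mult_nth)
    also have "\<dots> = (if ?p dvd n - ?p then fps_nth f (Suc ((n - ?p) div ?p)) else 0)"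
      using less.IH[of "n - ?p" "fps_shift 1 f"] le p(1) by simp
    also have "\<dots> = (if ?p dvd n then fps_nth f (n div ?p) else 0)"
      using le p(1) by (simp add: dvd_minus_self le_div_geq)
    finally show ?thesis .
  qed
qed

lemma power_card_eq_compose_power:
  fixes f :: "'p::prime_card mod_ring fls"
  shows "f ^ CARD('p) = fls_compose_power f CARD('p)"
proof -
  have p: "CARD('p) > 0" by simp
  obtain g where g: "f = fls_shift \<bar>fls_subdegree f\<bar> (fps_to_fls g)"
    using fls_as_fps'[OF abs_ge_minus_self] by blast
  have "g ^ CARD('p) = fps_compose g (fps_X ^ CARD('p))"
    by (rule fps_ext) (simp add: fps_nth_power_card fps_nth_compose_X_power)
  then have "fps_to_fls g ^ CARD('p) = fls_compose_power (fps_to_fls g) CARD('p)"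
    by (simp add: fls_compose_power_fps_to_fls flip: fps_to_fls_power)
  then show ?thesis
    by (subst (1 2) g) (simp add: fls_shifted_pow)
qed

lemma decimate_times_power_card:
  fixes f g :: "'p::prime_card mod_ring fls"
  assumes "r < CARD('p)"
  shows "decimate CARD('p) r (f * g ^ CARD('p)) = decimate CARD('p) r f * g"
  by (simp add: power_card_eq_compose_power decimate_times_compose_power[OF assms])

section \<open>Polynomials in T of bounded degree\<close>

definition polys_in_T :: "nat \<Rightarrow> 'k::field fls set" where
  "polys_in_T N = poly_in_T ` {p. Polynomial.degree p \<le> N}"

text \<open>As T = 1/X, the monomial T^j has exponent -j, so the degree bound becomes a condition on
  the support.\<close>

lemma mem_polys_in_T_iff: "f \<in> polys_in_T N \<longleftrightarrow> (\<forall>n. fls_nth f n \<noteq> 0 \<longrightarrow> - int N \<le> n \<and> n \<le> 0)"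
proof
  assume "f \<in> polys_in_T N"
  then obtain p where p: "f = poly_in_T p" "Polynomial.degree p \<le> N" by (auto simp: polys_in_T_def)
  then show "\<forall>n. fls_nth f n \<noteq> 0 \<longrightarrow> - int N \<le> n \<and> n \<le> 0"
    using le_degree[of p] by (fastforce simp: poly_in_T_nth split: if_splits)
next
  assume *: "\<forall>n. fls_nth f n \<noteq> 0 \<longrightarrow> - int N \<le> n \<and> n \<le> 0"
  define p where "p = Poly (map (\<lambda>j. fls_nth f (- int j)) [0..<Suc N])"
  have c: "Polynomial.coeff p j = (if j \<le> N then fls_nth f (- int j) else 0)" for j
    by (simp add: p_def nth_default_def del: upt_Suc)
  have "f = poly_in_T p"
    using * by (intro fls_eqI) (force simp: poly_in_T_nth c)
  moreover have "Polynomial.degree p \<le> N"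
    by (rule degree_le) (simp add: c)
  ultimately show "f \<in> polys_in_T N" by (auto simp: polys_in_T_def)
qed

lemma polys_in_T_mono: "M \<le> N \<Longrightarrow> f \<in> polys_in_T M \<Longrightarrow> f \<in> polys_in_T N"
  by (force simp: mem_polys_in_T_iff)

lemma zero_in_polys_in_T: "0 \<in> polys_in_T N"
  by (simp add: mem_polys_in_T_iff)

lemma diff_in_polys_in_T: "f \<in> polys_in_T N \<Longrightarrow> g \<in> polys_in_T N \<Longrightarrow> f - g \<in> polys_in_T N"
  by (force simp: mem_polys_in_T_iff)

lemma mult_in_polys_in_T:
  assumes "f \<in> polys_in_T M" "g \<in> polys_in_T N"
  shows "f * g \<in> polys_in_T (M + N)"
proof -
  obtain p q where "f = poly_in_T p" "g = poly_in_T q" "Polynomial.degree p \<le> M" "Polynomial.degree q \<le> N"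
    using assms by (auto simp: polys_in_T_def)
  then have "f * g = poly_in_T (p * q)" "Polynomial.degree (p * q) \<le> M + N"
    using degree_mult_le[of p q] by (simp_all add: poly_in_T_hom)
  then show ?thesis by (auto simp: polys_in_T_def)
qed

lemma finite_polys_in_T: "finite (polys_in_T N :: 'k::{field,finite} fls set)"
proof -
  have "f \<in> (\<lambda>xs. poly_in_T (Poly xs)) ` {xs. set xs \<subseteq> UNIV \<and> length xs \<le> Suc N}"
    if "f \<in> polys_in_T N" for f :: "'k fls"
  proof -
    obtain p where "f = poly_in_T p" "Polynomial.degree p \<le> N"
      using \<open>f \<in> polys_in_T N\<close> by (auto simp: polys_in_T_def)
    then show ?thesis
      by (intro image_eqI[of _ _ "coeffs p"]) (cases "p = 0"; auto simp: length_coeffs_degree)+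
  qed
  then have "polys_in_T N \<subseteq> (\<lambda>xs. poly_in_T (Poly xs)) ` {xs :: 'k list. set xs \<subseteq> UNIV \<and> length xs \<le> Suc N}"
    by blast
  then show ?thesis
    by (rule finite_subset) (intro finite_imageI finite_lists_length_le finite)
qed

text \<open>From pn + r >= -(N + M) >= -pN and r < p follows n > -N - 1. Multiplying by a factor of
  degree at most N and then decimating thus stays within one degree bound.\<close>

lemma decimate_in_polys_in_T:
  assumes f: "f \<in> polys_in_T (N + M)" and "M \<le> N" "r < p" "2 \<le> p"
  shows "decimate p r f \<in> polys_in_T N"
  unfolding mem_polys_in_T_iff
proof (intro allI impI)
  fix n
  assume "fls_nth (decimate p r f) n \<noteq> 0"
  then have *: "- int (N + M) \<le> int p * n + int r" "int p * n + int r \<le> 0"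
    using f assms(4) by (auto simp: decimate_nth mem_polys_in_T_iff)
  have "n \<le> 0"
  proof (rule ccontr)
    assume "\<not> n \<le> 0"
    then have "int p * n > 0" using assms(4) by simp
    then show False using *(2) by simp
  qed
  moreover have "- int N \<le> n"
  proof (rule ccontr)
    assume "\<not> - int N \<le> n"
    then have "int p * n \<le> int p * (- int N - 1)" by (intro mult_left_mono) auto
    moreover have "2 * int N \<le> int p * int N" using assms(4) by (intro mult_right_mono) auto
    ultimately show False using *(1) assms(2,3) by (simp add: algebra_simps)
  qed
  ultimately show "- int N \<le> n \<and> n \<le> 0" by simp
qed

lemma decimate_poly_in_T:
  assumes "f \<in> range poly_in_T" "r < p" "2 \<le> p"
  shows "decimate p r f \<in> range poly_in_T"
proof -
  obtain N where "f \<in> polys_in_T N" using assms(1) by (auto simp: polys_in_T_def)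
  then have "decimate p r f \<in> polys_in_T N"
    using decimate_in_polys_in_T[of f N N r p] polys_in_T_mono[of N "N + N" f] assms by simp
  then show ?thesis by (auto simp: polys_in_T_def)
qed

text \<open>
  While the coefficient of \<open>f\<close> vanishes, every term is a multiple of a \<open>p\<close>-th power, and a
  suitable Cartier operator extracts \<open>p\<close>-th roots without killing the relation.
\<close>
lemma frobenius_relation_leading_nonzero:
  fixes f :: "'p::prime_card mod_ring fls"
  assumes "\<And>i. i \<le> m \<Longrightarrow> b i \<in> range poly_in_T" "\<exists>i\<le>m. b i \<noteq> 0"
    and "(\<Sum>i\<le>m. b i * f ^ (CARD('p) ^ i)) = 0"
  shows "\<exists>m b. (\<forall>i\<le>m. b i \<in> range poly_in_T) \<and> b 0 \<noteq> 0 \<and> (\<Sum>i\<le>m. b i * f ^ (CARD('p) ^ i)) = 0"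
  using assms
proof (induction m arbitrary: b)
  case 0
  then show ?case by (intro exI[of _ 0] exI[of _ b]) auto
next
  case (Suc m)
  let ?p = "CARD('p)"
  have p: "2 \<le> ?p" using prime_card[where 'a = 'p] by (rule prime_ge_2_nat)
  show ?case
  proof (cases "b 0 = 0")
    case False
    then show ?thesis using Suc.prems by (intro exI[of _ "Suc m"] exI[of _ b]) auto
  next
    case True
    obtain i where i: "i \<le> m" "b (Suc i) \<noteq> 0"
      using Suc.prems(2) True by (metis Suc_le_mono old.nat.exhaust)
    then obtain n where n: "fls_nth (b (Suc i)) n \<noteq> 0" by (auto simp: fls_eq_iff)
    \<comment> \<open>\<open>r\<close> is the residue of an index at which a coefficient polynomial
      is nonzero, so this operator does not kill it.\<close>
    define r where "r = nat (n mod int ?p)"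
    have r: "r < ?p" and nr: "n = int ?p * (n div int ?p) + int r"
      using p by (simp_all add: r_def nat_less_iff)
    define b' where "b' = (\<lambda>i. decimate ?p r (b (Suc i)))"
    have "fls_nth (b' i) (n div int ?p) \<noteq> 0"
      using n nr p by (simp add: b'_def decimate_nth)
    then have "b' i \<noteq> 0" by auto
    have "0 = (\<Sum>i\<le>m. b (Suc i) * (f ^ (?p ^ i)) ^ ?p)"
      using Suc.prems(3) True by (simp add: sum.atMost_Suc_shift del: sum.atMost_Suc flip: power_mult) (simp add: mult.commute)
    then have "decimate ?p r 0 = decimate ?p r (\<Sum>i\<le>m. b (Suc i) * (f ^ (?p ^ i)) ^ ?p)" by simp
    then have "(\<Sum>i\<le>m. b' i * f ^ (?p ^ i)) = 0"
      using p r by (simp add: decimate_0 decimate_sum decimate_times_power_card b'_def)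
    moreover have "b' i \<in> range poly_in_T" if "i \<le> m" for i
      unfolding b'_def using that Suc.prems(1) r p by (intro decimate_poly_in_T) auto
    ultimately show ?thesis using i \<open>b' i \<noteq> 0\<close> by (intro Suc.IH[of b']) auto
  qed
qed

section \<open>Finiteness of the set of decimations\<close>

text \<open>Once \<open>b 0\<close> is nonzero, g = f / b 0 is a combination of its own powers
  g^(p^i) with i >= 1. The combinations of g^(p^i), i <= m, with coefficients of bounded degree form
  a finite set that contains f and is closed under the Cartier operators.\<close>

lemma frobenius_relation_imp_finite_decimations:
  fixes f :: "'p::prime_card mod_ring fls"
  assumes "\<And>i. i \<le> m \<Longrightarrow> b i \<in> range poly_in_T" "\<exists>i\<le>m. b i \<noteq> 0"
    and "(\<Sum>i\<le>m. b i * f ^ (CARD('p) ^ i)) = 0"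
  shows "finite {decimate (CARD('p) ^ k) r f | k r. r < CARD('p) ^ k}"
proof -
  let ?p = "CARD('p)"
  have p: "2 \<le> ?p" using prime_card[where 'a = 'p] by (rule prime_ge_2_nat)
  obtain m b where b: "\<And>i. i \<le> m \<Longrightarrow> b i \<in> range poly_in_T" and b0: "b 0 \<noteq> 0"
      and rel: "(\<Sum>i\<le>m. b i * f ^ (?p ^ i)) = 0"
    using frobenius_relation_leading_nonzero[OF assms] by blast
  \<comment> \<open>Substituting f = b 0 * g and dividing the relation by the square of
    \<open>b 0\<close> leaves these coefficients; for i >= 1 the exponent is a true difference since
    2 <= p^i.\<close>
  define e where "e = (\<lambda>i. b i * b 0 ^ (?p ^ i - 2))"
  define g where "g = f / b 0"
  have f: "f = b 0 * g" using b0 by (simp add: g_def)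
  have p_pow: "?p ^ Suc i = Suc (Suc (?p ^ Suc i - 2))" for i
  proof -
    have "2 ^ 1 \<le> ?p ^ Suc i" using p by (intro order.trans[OF power_mono power_increasing]) auto
    then show ?thesis by simp
  qed
  have g: "g = - (\<Sum>i<m. e (Suc i) * g ^ (?p ^ Suc i))"
  proof -
    have "b (Suc i) * f ^ (?p ^ Suc i) = (b 0 * b 0) * (e (Suc i) * g ^ (?p ^ Suc i))" for i
    proof -
      have "b 0 ^ (?p ^ Suc i) = b 0 * b 0 * b 0 ^ (?p ^ Suc i - 2)"
        by (subst p_pow) (simp del: power_Suc add: power_Suc[of "b 0"] mult.assoc)
      then show ?thesis unfolding f e_def power_mult_distrib by (simp only: ac_simps)
    qed
    then have "0 = b 0 * b 0 * g + (\<Sum>i<m. (b 0 * b 0) * (e (Suc i) * g ^ (?p ^ Suc i)))"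
      using rel by (simp add: lessThan_Suc_atMost[symmetric] sum.lessThan_Suc_shift f mult.assoc
          del: sum.lessThan_Suc power_Suc)
    also have "\<dots> = b 0 * b 0 * (g + (\<Sum>i<m. e (Suc i) * g ^ (?p ^ Suc i)))"
      by (simp only: sum_distrib_left distrib_left)
    finally show ?thesis using b0 by (simp add: eq_neg_iff_add_eq_0)
  qed
  have e_poly: "\<exists>N. e i \<in> polys_in_T N" if i: "i \<le> m" for i
  proof -
    obtain q0 q where "b 0 = poly_in_T q0" "b i = poly_in_T q"
      using b[of 0] b[OF i] by auto
    moreover have "poly_in_T (q * q0 ^ n) = poly_in_T q * poly_in_T q0 ^ n" for n
      by (induction n) (simp_all add: poly_in_T_hom mult_ac)
    ultimately have "e i = poly_in_T (q * q0 ^ (?p ^ i - 2))" by (simp add: e_def)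
    then show ?thesis by (auto simp: polys_in_T_def)
  qed
  then obtain M where M: "\<And>i. i \<le> m \<Longrightarrow> e i \<in> polys_in_T (M i)" by metis
  obtain M0 where M0: "b 0 \<in> polys_in_T M0" using b[of 0] by (auto simp: polys_in_T_def)
  define N where "N = M0 + (\<Sum>i\<le>m. M i)"
  have eN: "e i \<in> polys_in_T N" if "i \<le> m" for i
    using polys_in_T_mono[OF _ M[OF that]] member_le_sum[of i "{..m}" M] that by (simp add: N_def)
  have bN: "b 0 \<in> polys_in_T N" using polys_in_T_mono[OF _ M0] by (simp add: N_def)
  define H where "H = (\<lambda>c. \<Sum>i\<le>m. c i * g ^ (?p ^ i)) ` ({..m} \<rightarrow>\<^sub>E polys_in_T N)"
  have "finite H" unfolding H_def by (intro finite_imageI finite_PiE finite_polys_in_T) simp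
  have HI: "(\<Sum>i\<le>m. c i * g ^ (?p ^ i)) \<in> H" if "\<And>i. i \<le> m \<Longrightarrow> c i \<in> polys_in_T N" for c
  proof -
    have "(\<Sum>i\<le>m. c i * g ^ (?p ^ i)) = (\<Sum>i\<le>m. restrict c {..m} i * g ^ (?p ^ i))" by simp
    then show ?thesis unfolding H_def using that by (intro image_eqI[of _ _ "restrict c {..m}"]) auto
  qed
  have "f \<in> H"
  proof -
    have "(\<Sum>i\<le>m. (if i = 0 then b 0 else 0) * g ^ (?p ^ i)) = f"
      by (simp add: f if_distrib[of "\<lambda>x. x * _"] cong: if_cong)
    moreover have "(\<Sum>i\<le>m. (if i = 0 then b 0 else 0) * g ^ (?p ^ i)) \<in> H"
      using bN by (intro HI) (auto simp: zero_in_polys_in_T)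
    ultimately show ?thesis by simp
  qed
  have H_closed: "decimate ?p r h \<in> H" if "h \<in> H" "r < ?p" for h r
  proof -
    obtain c where c: "\<And>i. i \<le> m \<Longrightarrow> c i \<in> polys_in_T N" and h: "h = (\<Sum>i\<le>m. c i * g ^ (?p ^ i))"
      using \<open>h \<in> H\<close> by (auto simp: H_def)
    \<comment> \<open>The equation for \<open>g\<close> replaces the term \<open>c 0 * g\<close>.
      Then every power of \<open>g\<close> left is a p-th power and its root can be
      extracted.\<close>
    define d where "d = (\<lambda>i. c (Suc i) - c 0 * e (Suc i))"
    have "h = c 0 * g + (\<Sum>i<m. c (Suc i) * g ^ (?p ^ Suc i))"
      unfolding h by (simp add: lessThan_Suc_atMost[symmetric] sum.lessThan_Suc_shift
          del: sum.lessThan_Suc power_Suc)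
    also have "\<dots> = c 0 * (- (\<Sum>i<m. e (Suc i) * g ^ (?p ^ Suc i))) + (\<Sum>i<m. c (Suc i) * g ^ (?p ^ Suc i))"
      using g by simp
    also have "\<dots> = (\<Sum>i<m. d i * g ^ (?p ^ Suc i))"
      by (simp add: d_def left_diff_distrib sum_subtractf sum_distrib_left mult.assoc del: power_Suc)
    also have "\<dots> = (\<Sum>i<m. d i * (g ^ (?p ^ i)) ^ ?p)"
      by (simp add: mult.commute flip: power_mult)
    finally have "decimate ?p r h = (\<Sum>i<m. decimate ?p r (d i) * g ^ (?p ^ i))"
      using p that(2) by (simp add: decimate_sum decimate_times_power_card)
    also have "\<dots> = (\<Sum>i\<le>m. (if i < m then decimate ?p r (d i) else 0) * g ^ (?p ^ i))"
      by (simp flip: lessThan_Suc_atMost)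
    also have "\<dots> \<in> H"
    proof (rule HI)
      fix i assume "i \<le> m"
      have "decimate ?p r (d i) \<in> polys_in_T N" if "i < m"
      proof (rule decimate_in_polys_in_T[OF _ order_refl \<open>r < ?p\<close> p])
        show "d i \<in> polys_in_T (N + N)"
          unfolding d_def using that c eN
          by (intro diff_in_polys_in_T mult_in_polys_in_T polys_in_T_mono[of N "N + N" "c (Suc i)"]) auto
      qed
      then show "(if i < m then decimate ?p r (d i) else 0) \<in> polys_in_T N"
        by (simp add: zero_in_polys_in_T)
    qed
    finally show ?thesis .
  qed
  have "decimate (?p ^ k) r f \<in> H" if "r < ?p ^ k" for k r
    using that
  proof (induction k arbitrary: r)
    case 0
    have "decimate 1 0 f = f" by (simp add: fls_eq_iff decimate_nth)
    then show ?case using 0 \<open>f \<in> H\<close> by simp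
  next
    case (Suc k)
    have pos: "?p ^ k > 0" using p by simp
    \<comment> \<open>Splitting off the leading base-p digit of \<open>r\<close> presents level k +
      1 as one Cartier operator applied to level k.\<close>
    have "r div ?p ^ k < ?p" using Suc.prems by (simp add: less_mult_imp_div_less)
    then have "decimate ?p (r div ?p ^ k) (decimate (?p ^ k) (r mod ?p ^ k) f) \<in> H"
      using Suc.IH[of "r mod ?p ^ k"] pos by (intro H_closed) auto
    then show ?case using pos p by (simp add: decimate_decimate mult.commute[of ?p])
  qed
  then have "{decimate (?p ^ k) r f | k r. r < ?p ^ k} \<subseteq> H" by blast
  then show ?thesis using \<open>finite H\<close> by (rule finite_subset)
qed

section \<open>Transcendence\<close>

text \<open>The product of the individual multipliers works. This clears denominators in K(T), with
  \<open>S\<close> the polynomials in T, and in the rationals, with \<open>S\<close> the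
  integers.\<close>

lemma exists_common_multiplier:
  fixes f :: "'a \<Rightarrow> 'b::idom"
  assumes "finite A" "1 \<in> S" "\<And>x y. x \<in> S \<Longrightarrow> y \<in> S \<Longrightarrow> x * y \<in> S"
    and "\<And>a. a \<in> A \<Longrightarrow> \<exists>n\<in>S. n \<noteq> 0 \<and> n * f a \<in> S"
  shows "\<exists>n\<in>S. n \<noteq> 0 \<and> (\<forall>a\<in>A. n * f a \<in> S)"
  using assms(1,4)
proof (induction A rule: finite_induct)
  case empty
  show ?case using assms(2) by (intro bexI[of _ 1]) auto
next
  case (insert a A)
  have "\<exists>n\<in>S. n \<noteq> 0 \<and> (\<forall>a\<in>A. n * f a \<in> S)" using insert.prems by (intro insert.IH) auto
  then obtain n where n: "n \<in> S" "n \<noteq> 0" "\<And>x. x \<in> A \<Longrightarrow> n * f x \<in> S" by blast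
  obtain k where k: "k \<in> S" "k \<noteq> 0" "k * f a \<in> S" using insert.prems by blast
  have "n * k * f x \<in> S" if "x \<in> insert a A" for x
  proof (cases "x = a")
    case True
    then show ?thesis using n(1) k(3) assms(3)[of n "k * f a"] by (simp add: mult.assoc)
  next
    case False
    then show ?thesis using that n(3)[of x] k(1) assms(3)[of k "n * f x"] by (simp add: mult_ac)
  qed
  then show ?case using n k assms(3) by (intro bexI[of _ "n * k"]) auto
qed

lemma combine_eq_sum:
  fixes Ks Us :: "'a::comm_ring_1 list"
  shows "length Ks = length Us \<Longrightarrow>
    ring.combine ring_of_type_algebra Ks Us = (\<Sum>i<length Us. Ks ! i * Us ! i)"
proof -
  interpret R: Ring.ring "ring_of_type_algebra :: 'a ring"
    using ring_from_type_algebra[where 'a = 'a] by simp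
  have s: "ring.zero (ring_of_type_algebra :: 'a ring) = 0" "add (ring_of_type_algebra :: 'a ring) = (+)"
    "monoid.mult (ring_of_type_algebra :: 'a ring) = (*)"
    by (simp_all add: ring_of_type_algebra_def)
  show "length Ks = length Us \<Longrightarrow> R.combine Ks Us = (\<Sum>i<length Us. Ks ! i * Us ! i)"
    by (induction Ks Us rule: list_induct2)
      (simp_all add: s sum.lessThan_Suc_shift del: sum.lessThan_Suc)
qed

text \<open>An algebraic \<open>x\<close> generates an extension of finite dimension n, so any n + 1
  powers of it are dependent over K(T); denominators are then cleared. The exponents stay free so
  that prime powers can be chosen.\<close>

lemma algebraic_imp_powers_dependent:
  fixes x :: "'k::field fls" and e :: "nat \<Rightarrow> nat"
  assumes alg: "\<not> (ring.transcendental ring_of_type_algebra over rational_functions) x"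
  shows "\<exists>m c. (\<exists>i\<le>m. c i \<noteq> 0) \<and> (\<Sum>i\<le>m. poly_in_T (c i) * x ^ e i) = 0"
proof -
  let ?R = "ring_of_type_algebra :: 'k fls ring"
  let ?K = "rational_functions :: 'k fls set"
  interpret F: Ring.field ?R by (rule field_from_type_algebra)
  have simps: "carrier ?R = UNIV" "monoid.mult ?R = (*)" "one ?R = 1" "ring.zero ?R = 0"
    by (simp_all add: ring_of_type_algebra_def)
  note K = subfield_rational_functions[where 'k = 'k]
  let ?E = "F.simple_extension ?K x"
  obtain n where dim: "F.dimension n ?K ?E"
    using F.dimension_simple_extension[OF K, of x] alg by (auto simp: simps over_def)
  have E: "subring ?E ?R" "x \<in> ?E"
    using F.simple_extension_is_subring[OF subfieldE(1)[OF K]]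
      F.simple_extension_mem[OF subfieldE(1)[OF K]] by (simp_all add: simps)
  have pow: "x ^ k \<in> ?E" for k
    using subringE(3,6)[OF E(1)] E(2) by (induction k) (auto simp: simps)
  define Us where "Us = map (\<lambda>i. x ^ e i) [0..<Suc n]"
  have "set Us \<subseteq> ?E" using pow by (auto simp: Us_def)
  then have dep: "F.dependent ?K Us"
    using F.independent_length_le_dimension[OF K dim, of Us] by (auto simp: Us_def)
  have "set Us \<subseteq> carrier ?R" by (simp add: simps)
  then obtain Ks where "length Ks = length Us" "F.combine Ks Us = \<zero>\<^bsub>?R\<^esub>"
      "set Ks \<subseteq> ?K" "set Ks \<noteq> {\<zero>\<^bsub>?R\<^esub>}"
    by (rule F.dependent_imp_non_trivial_combine[OF K _ dep])
  note Ks = this[unfolded simps]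
  have len: "length Us = Suc n" by (simp add: Us_def)
  have "0 = (\<Sum>i<Suc n. Ks ! i * Us ! i)"
    using combine_eq_sum[OF Ks(1)] Ks(2) len by simp
  also have "\<dots> = (\<Sum>i\<le>n. Ks ! i * x ^ e i)"
    unfolding lessThan_Suc_atMost by (intro sum.cong) (simp_all add: Us_def del: upt_Suc)
  finally have rel: "(\<Sum>i\<le>n. Ks ! i * x ^ e i) = 0" ..
  have "\<exists>d\<in>range poly_in_T. d \<noteq> 0 \<and> d * Ks ! i \<in> range poly_in_T" if "i \<in> {..n}" for i
  proof -
    have "i < length Ks" using that Ks(1) len by simp
    then have "Ks ! i \<in> ?K" using Ks(3) nth_mem by blast
    then obtain p q where "Ks ! i = poly_in_T p / poly_in_T q" "q \<noteq> 0"
      by (auto simp: rational_functions_def)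
    then show ?thesis
      by (intro bexI[of _ "poly_in_T q"]) (auto simp: poly_in_T_eq_0_iff)
  qed
  moreover have "1 \<in> range (poly_in_T :: 'k poly \<Rightarrow> _)" by (metis poly_in_T_hom(5) rangeI)
  moreover have "f * g \<in> range (poly_in_T :: 'k poly \<Rightarrow> _)"
    if "f \<in> range poly_in_T" "g \<in> range poly_in_T" for f g
    using that by (auto simp flip: poly_in_T_hom)
  ultimately obtain d where d: "d \<noteq> 0" "\<forall>i\<in>{..n}. d * Ks ! i \<in> range poly_in_T"
    using exists_common_multiplier[of "{..n}" "range poly_in_T" "\<lambda>i. Ks ! i"] by auto
  then have "\<forall>i. \<exists>p. i \<le> n \<longrightarrow> d * Ks ! i = poly_in_T p" by (auto simp: image_iff)
  then obtain c where c: "\<And>i. i \<le> n \<Longrightarrow> d * Ks ! i = poly_in_T (c i)" by metis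
  \<comment> \<open>That \<open>set Ks\<close> differs from {0} yields a nonzero entry because the
    list is nonempty.\<close>
  have "\<exists>i\<le>n. Ks ! i \<noteq> 0"
  proof (rule ccontr)
    assume "\<not> ?thesis"
    then have "set Ks \<subseteq> {0}" using Ks(1) len by (auto simp: in_set_conv_nth less_Suc_eq_le)
    moreover have "Ks \<noteq> []" using Ks(1) len by auto
    ultimately show False using Ks(4) by (metis set_empty subset_singletonD)
  qed
  then have "\<exists>i\<le>n. c i \<noteq> 0" using c d(1) by (metis mult_eq_0_iff poly_in_T_hom(4))
  moreover have "(\<Sum>i\<le>n. poly_in_T (c i) * x ^ e i) = d * (\<Sum>i\<le>n. Ks ! i * x ^ e i)"
    by (simp add: sum_distrib_left mult.assoc flip: c)
  ultimately show ?thesis using rel by auto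
qed

section \<open>The contradiction over F_p\<close>

text \<open>A nontrivial relation would leave finitely many decimations of \<open>theta\<close>, but
  the p^k decimations of each level k are pairwise distinct.\<close>

lemma theta_frobenius_powers_independent:
  assumes "(\<Sum>i\<le>m. poly_in_T (c i) * (theta :: 'p::prime_card mod_ring fls) ^ (CARD('p) ^ i)) = 0"
    and "i \<le> m"
  shows "c i = 0"
proof (rule ccontr)
  let ?p = "CARD('p)" and ?\<theta> = "theta :: 'p mod_ring fls"
  assume "c i \<noteq> 0"
  then have fin: "finite {decimate (?p ^ k) r ?\<theta> | k r. r < ?p ^ k}" (is "finite ?D")
    using assms frobenius_relation_imp_finite_decimations[of m "\<lambda>i. poly_in_T (c i)" ?\<theta>]
    by (auto simp: poly_in_T_eq_0_iff)
  have p: "?p > 1" using prime_card[where 'a = 'p] by (rule prime_gt_1_nat)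
  have distinct: "decimate q r ?\<theta> \<noteq> decimate q r' ?\<theta>" if qr: "q > 0" "r < r'" for q r r'
  proof -
    obtain n where n: "n \<ge> 1" "w (q * n + r) \<noteq> w (q * n + r')"
      using w_progressions_differ[OF qr] by blast
    have ge: "1 \<le> q * n + r" "1 \<le> q * n + r'" using n qr by (simp_all add: Suc_le_eq)
    have nth: "fls_nth (decimate q s ?\<theta>) (int n) = of_nat (w (q * n + s))" if "1 \<le> q * n + s" for s
    proof -
      have "fls_nth (decimate q s ?\<theta>) (int n) = fls_nth ?\<theta> (int (q * n + s))"
        using \<open>q > 0\<close> by (simp add: decimate_nth)
      moreover have "1 \<le> int (q * n + s)" using that by linarith
      ultimately show ?thesis by (simp only: theta_nth nat_int if_True)
    qed
    \<comment> \<open>The two letters differ by 1, so they stay distinct even in characteristic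
      2.\<close>
    have "(of_nat 1 :: 'p mod_ring) \<noteq> of_nat 2"
      by (metis add_cancel_right_right of_nat_1 one_add_one of_nat_numeral zero_neq_one)
    then have "of_nat (w (q * n + r)) \<noteq> (of_nat (w (q * n + r')) :: 'p mod_ring)"
      using w_range[OF ge(1)] w_range[OF ge(2)] n(2) by auto
    then show ?thesis using nth[OF ge(1)] nth[OF ge(2)] by metis
  qed
  have card: "?p ^ k \<le> card ?D" for k
  proof -
    have "inj_on (\<lambda>r. decimate (?p ^ k) r ?\<theta>) {..<?p ^ k}"
      using distinct[of "?p ^ k"] by (intro linorder_inj_onI) auto
    moreover have "(\<lambda>r. decimate (?p ^ k) r ?\<theta>) ` {..<?p ^ k} \<subseteq> ?D" by blast
    ultimately have "card {..<?p ^ k} \<le> card ?D" by (rule card_inj_on_le[OF _ _ fin])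
    then show ?thesis by (simp only: card_lessThan)
  qed
  have "n < ?p ^ n" for n
    using p by (simp add: power_gt_expt)
  then show False using card not_less by blast
qed

section \<open>Reduction from the rationals to the field with two elements\<close>

text \<open>The factor is the gcd t of the values: if all quotients were even, 2t would divide
  t.\<close>

lemma exists_odd_cofactor:
  fixes z :: "'a \<Rightarrow> int"
  assumes "\<exists>a\<in>A. z a \<noteq> 0"
  shows "\<exists>t z'. t \<noteq> 0 \<and> (\<forall>a\<in>A. z a = t * z' a) \<and> (\<exists>a\<in>A. odd (z' a))"
proof -
  define t where "t = Gcd (z ` A)"
  have t: "t \<noteq> 0" using assms by (auto simp: t_def)
  have dvd: "t dvd z a" if "a \<in> A" for a using that by (simp add: t_def)
  have "\<exists>a\<in>A. odd (z a div t)"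
  proof (rule ccontr)
    assume "\<not> ?thesis"
    then have "t * 2 dvd z a" if "a \<in> A" for a
      using that dvd[OF that] t by (metis dvd_mult_div_cancel mult_dvd_mono dvd_refl)
    then have "t * 2 dvd t" unfolding t_def by (intro Gcd_greatest) auto
    then have "t * 2 dvd t * 1" by simp
    then show False using t by (simp only: dvd_mult_cancel_left) auto
  qed
  then show ?thesis using t dvd by (intro exI[of _ t] exI[of _ "\<lambda>a. z a div t"]) auto
qed

text \<open>Multiplication by T^j moves the coefficient at k + j to k. A common bound
  \<open>D\<close> gives all products in a relation the same range of summation.\<close>

lemma nth_poly_in_T_times:
  assumes "Polynomial.degree q \<le> D"
  shows "fls_nth (poly_in_T q * f) k = (\<Sum>j\<le>D. Polynomial.coeff q j * fls_nth f (k + int j))"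
proof -
  have "fls_nth (poly_in_T q * f) k = (\<Sum>j\<le>D. Polynomial.coeff q j * fls_nth f (k + int j))"
    if "\<forall>j>D. Polynomial.coeff q j = 0" for D
    using that
  proof (induction q arbitrary: k D)
    case 0
    show ?case by (simp add: poly_in_T_hom)
  next
    case (pCons a q)
    have eq: "poly_in_T (pCons a q) = fls_const a + fls_X_inv * poly_in_T q"
      using pCons.hyps by (simp add: poly_in_T_def map_poly_pCons)
    show ?case
    proof (cases D)
      case 0
      then have "q = 0" using pCons.prems by (force simp: poly_eq_iff coeff_pCons split: nat.splits)
      then show ?thesis unfolding eq by (simp add: 0 poly_in_T_hom)
    next
      case (Suc D')
      have "\<forall>j>D'. Polynomial.coeff q j = 0" using pCons.prems Suc by (metis Suc_less_eq coeff_pCons_Suc)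
      then have IH: "fls_nth (poly_in_T q * f) (k + 1)
          = (\<Sum>j\<le>D'. Polynomial.coeff q j * fls_nth f (k + 1 + int j))"
        by (rule pCons.IH)
      have "poly_in_T (pCons a q) * f = fls_const a * f + fls_X_inv * (poly_in_T q * f)"
        by (simp only: eq distrib_right mult.assoc)
      then show ?thesis
        unfolding Suc
        by (simp add: fls_X_inv_times_conv_shift(1) IH sum.atMost_Suc_shift add.assoc del: sum.atMost_Suc)
    qed
  qed
  then show ?thesis using assms by (simp add: coeff_eq_0)
qed

text \<open>The coefficients of \<open>theta\<close> are images of integers, so those of its powers
  come from one integer series independent of the field.\<close>

lemma nth_theta_power:
  "fls_nth ((theta :: 'k::field fls) ^ e) k =
    of_int (if k < 0 then 0 else fps_nth (Abs_fps (\<lambda>n. if n = 0 then 0 else int (w n)) ^ e) (nat k))"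
proof -
  let ?t = "Abs_fps (\<lambda>n. if n = 0 then 0 else int (w n))"
  have "fps_nth (Abs_fps (\<lambda>n. if n = 0 then 0 else of_nat (w n) :: 'k) ^ e) n = of_int (fps_nth (?t ^ e) n)" for n
  proof (induction e arbitrary: n)
    case (Suc e)
    show ?case by (auto simp: fps_mult_nth Suc.IH intro!: sum.cong)
  qed (simp add: fps_one_nth)
  then show ?thesis by (simp add: theta_def flip: fps_to_fls_power)
qed

text \<open>Comparing coefficients turns the scaled relation into integer identities. After division
  by the common factor some coefficient is odd, so reduction modulo 2 keeps the relation
  nontrivial.\<close>

lemma theta_relation_mod_2:
  fixes c :: "nat \<Rightarrow> rat poly" and e :: "nat \<Rightarrow> nat"
  assumes rel: "(\<Sum>i\<le>m. poly_in_T (c i) * (theta :: rat fls) ^ e i) = 0" and nz: "\<exists>i\<le>m. c i \<noteq> 0"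
  shows "\<exists>c'. (\<exists>i\<le>m. c' i \<noteq> 0) \<and> (\<Sum>i\<le>m. poly_in_T (c' i) * (theta :: bool mod_ring fls) ^ e i) = 0"
proof -
  define D where "D = (\<Sum>i\<le>m. Polynomial.degree (c i))"
  have D: "Polynomial.degree (c i) \<le> D" if "i \<le> m" for i
    unfolding D_def using that by (intro member_le_sum) auto
  define A where "A = {..m} \<times> {..D}"
  define u where "u = (\<lambda>i k. if k < 0 then 0 else
    fps_nth (Abs_fps (\<lambda>n. if n = 0 then 0 else int (w n)) ^ e i) (nat k))"
  have u: "fls_nth (theta ^ e i) k = of_int (u i k)" for i k
    unfolding nth_theta_power u_def ..
  have u2: "fls_nth ((theta :: bool mod_ring fls) ^ e i) k = of_int (u i k)" for i k
    unfolding nth_theta_power u_def ..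
  have "\<exists>n\<in>\<int>. n \<noteq> 0 \<and> n * r \<in> \<int>" for r :: rat
  proof (cases r)
    case (Fract a b)
    then show ?thesis by (intro bexI[of _ "of_int b"]) (auto simp: Fract_of_int_quotient)
  qed
  then obtain N :: rat where N: "N \<noteq> 0" "\<And>a. a \<in> A \<Longrightarrow> N * (case a of (i, j) \<Rightarrow> Polynomial.coeff (c i) j) \<in> \<int>"
    using exists_common_multiplier[of A \<int> "\<lambda>(i, j). Polynomial.coeff (c i) j"] by (auto simp: A_def)
  \<comment> \<open>On \<open>A\<close> the factor \<open>N\<close> has cleared the denominators, so
    the floor only changes the type.\<close>
  define z where "z = (\<lambda>(i, j). \<lfloor>N * Polynomial.coeff (c i) j\<rfloor>)"
  have z: "of_int (z (i, j)) = N * Polynomial.coeff (c i) j" if "i \<le> m" "j \<le> D" for i j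
    using N(2)[of "(i, j)"] that by (auto simp: z_def A_def elim!: Ints_cases)
  obtain i0 where i0: "i0 \<le> m" "c i0 \<noteq> 0" using nz by blast
  have "(of_int (z (i0, Polynomial.degree (c i0))) :: rat) \<noteq> 0"
    using i0 N(1) D[OF i0(1)] by (simp add: z)
  then have "z (i0, Polynomial.degree (c i0)) \<noteq> 0" by simp
  moreover have "(i0, Polynomial.degree (c i0)) \<in> A" using i0(1) D[OF i0(1)] by (simp add: A_def)
  ultimately have "\<exists>a\<in>A. z a \<noteq> 0" by blast
  then obtain t z' where t: "t \<noteq> 0" "\<And>a. a \<in> A \<Longrightarrow> z a = t * z' a" "\<exists>a\<in>A. odd (z' a)"
    using exists_odd_cofactor[of A z] by blast
  \<comment> \<open>Multiplied by \<open>N\<close>, the coefficient at \<open>k\<close> of the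
    rational relation is \<open>t\<close> times this sum, and \<open>t\<close> cancels.\<close>
  have int_rel: "(\<Sum>i\<le>m. \<Sum>j\<le>D. z' (i, j) * u i (k + int j)) = 0" for k
  proof -
    have "of_int t * of_int (\<Sum>i\<le>m. \<Sum>j\<le>D. z' (i, j) * u i (k + int j))
        = (\<Sum>i\<le>m. \<Sum>j\<le>D. (of_int (t * z' (i, j)) :: rat) * of_int (u i (k + int j)))"
      by (simp add: sum_distrib_left mult.assoc)
    also have "\<dots> = (\<Sum>i\<le>m. \<Sum>j\<le>D. N * (Polynomial.coeff (c i) j * fls_nth (theta ^ e i) (k + int j)))"
    proof (intro sum.cong refl)
      fix i j assume "i \<in> {..m}" "j \<in> {..D}"
      then have "of_int (t * z' (i, j)) = N * Polynomial.coeff (c i) j"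
        using t(2)[of "(i, j)"] z[of i j] by (simp add: A_def)
      then show "of_int (t * z' (i, j)) * of_int (u i (k + int j))
          = N * (Polynomial.coeff (c i) j * fls_nth (theta ^ e i) (k + int j))"
        by (simp only: u mult.assoc)
    qed
    also have "\<dots> = N * fls_nth (\<Sum>i\<le>m. poly_in_T (c i) * theta ^ e i) k"
      by (simp add: fls_nth_sum nth_poly_in_T_times[OF D] sum_distrib_left)
    also have "\<dots> = 0" by (simp only: rel) simp
    finally show ?thesis using t(1) by (auto simp only: mult_eq_0_iff of_int_eq_0_iff)
  qed
  define c' where "c' = (\<lambda>i. Poly (map (\<lambda>j. of_int (z' (i, j)) :: bool mod_ring) [0..<Suc D]))"
  have c': "Polynomial.coeff (c' i) j = (if j \<le> D then of_int (z' (i, j)) else 0)" for i j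
    by (simp add: c'_def nth_default_def del: upt_Suc)
  have deg: "Polynomial.degree (c' i) \<le> D" for i by (rule degree_le) (simp add: c')
  have "(\<Sum>i\<le>m. poly_in_T (c' i) * (theta :: bool mod_ring fls) ^ e i) = 0"
  proof (rule fls_eqI)
    fix k
    have "fls_nth (\<Sum>i\<le>m. poly_in_T (c' i) * (theta :: bool mod_ring fls) ^ e i) k
        = of_int (\<Sum>i\<le>m. \<Sum>j\<le>D. z' (i, j) * u i (k + int j))"
      by (simp add: fls_nth_sum nth_poly_in_T_times[OF deg] c' u2)
    then show "fls_nth (\<Sum>i\<le>m. poly_in_T (c' i) * (theta :: bool mod_ring fls) ^ e i) k = fls_nth 0 k"
      by (simp add: int_rel)
  qed
  moreover have "\<exists>i\<le>m. c' i \<noteq> 0"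
  proof -
    obtain i j where ij: "i \<le> m" "j \<le> D" "odd (z' (i, j))" using t(3) by (auto simp: A_def)
    have "CHAR(bool mod_ring) = 2" by simp
    then have "(of_int (z' (i, j)) :: bool mod_ring) \<noteq> 0"
      using ij(3) of_int_eq_0_iff_char_dvd[where 'a = "bool mod_ring"] by simp
    then have "Polynomial.coeff (c' i) j \<noteq> 0" using ij by (simp add: c')
    then show ?thesis using ij(1) by (intro exI[of _ i]) auto
  qed
  ultimately show ?thesis by blast
qed

theorem mainTheorem3:
  shows "(ring.transcendental ring_of_type_algebra over rational_functions)
           (theta :: 'p :: prime_card mod_ring fls)
       \<and> (ring.transcendental ring_of_type_algebra over rational_functions)
           (theta :: rat fls)"
proof
  show "(ring.transcendental ring_of_type_algebra over rational_functions) (theta :: 'p mod_ring fls)"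
    using algebraic_imp_powers_dependent[of "theta :: 'p mod_ring fls" "\<lambda>i. CARD('p) ^ i"]
      theta_frobenius_powers_independent by blast
  show "(ring.transcendental ring_of_type_algebra over rational_functions) (theta :: rat fls)"
  proof (rule ccontr)
    assume "\<not> ?thesis"
    \<comment> \<open>Writing 2 as \<open>CARD(bool)\<close> puts the exponents into the form of the
      independence lemma over \<open>bool mod_ring\<close>.\<close>
    then obtain m c where "\<exists>i\<le>m. c i \<noteq> 0"
        "(\<Sum>i\<le>m. poly_in_T (c i) * (theta :: rat fls) ^ (CARD(bool) ^ i)) = 0"
      using algebraic_imp_powers_dependent[of "theta :: rat fls" "\<lambda>i. CARD(bool) ^ i"] by blast
    then show False
      using theta_relation_mod_2[where c = c and m = m and e = "\<lambda>i. CARD(bool) ^ i"] theta_frobenius_powers_independent by blast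
  qed
qed

end
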